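(* Let $0<a<1$ and $0\le b<1$. The invariant set $\Lambda_\pm:=\bigcap_{n=0}^\infty f_\pm^n([0,1])$ has Hausdorff dimension $0$. Moreover, the Hausdorff measure $\mathcal H_h(\Lambda_\pm)$ is finite for the gauge function $h(t)=1/|\log t|$.
   Context: For real $x$ let $\{x\}:=x-\lfloor x\rfloor\in[0,1)$ and $\{x\}_+:=1-\{-x\}\in(0,1]$. For constants $0<a<1$, $0\le b<1$ define $f_-,f_+:[0,1]\to[0,1]$ by $f_-(x)=\{ax+b\}$, $f_+(x)=\{ax+b\}_+$, and let $f_\pm$ be the multi-valued map $x\mapsto\{f_-(x),f_+(x)\}$. For $K\subseteq[0,1]$, $f_\pm(K):=f_-(K)\cup f_+(K)$, and $f_\pm^n$ denotes the $n$-th iterate of this set map. For a gauge function $h$ (increasing, defined for small $t>0$, with $h(t)\to0$ as $t\to0$; set $h(0)=0$), $\mathcal H_h(E):=\lim_{\delta\to0}\inf\{\sum_k h(\operatorname{diam} U_k): E\subseteq\bigcup_k U_k,\ \operatorname{diam}U_k\le\delta\}$, the infimum over countable covers. *)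

theory Defs
  imports "HOL-Analysis.Analysis"
begin

section \<open>Multi-valued contracted rotations\<close>

definition frac_plus :: "real \<Rightarrow> real" where
  "frac_plus x = 1 - frac (- x)"

definition f_minus :: "real \<Rightarrow> real \<Rightarrow> real \<Rightarrow> real" where
  "f_minus a b x = frac (a * x + b)"

definition f_plus :: "real \<Rightarrow> real \<Rightarrow> real \<Rightarrow> real" where
  "f_plus a b x = frac_plus (a * x + b)"

definition f_pm :: "real \<Rightarrow> real \<Rightarrow> real set \<Rightarrow> real set" where
  "f_pm a b K = f_minus a b ` K \<union> f_plus a b ` K"

definition Lambda_pm :: "real \<Rightarrow> real \<Rightarrow> real set" where
  "Lambda_pm a b = (\<Inter>n. (f_pm a b ^^ n) {0..1})"

section \<open>Hausdorff measures and Hausdorff dimension\<close>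

text \<open>Boundedness is required because \<^const>\<open>diameter\<close> is unspecified on unbounded sets.
  Finite covers are included: they can be padded with empty sets, of diameter \<open>0\<close>, and
  gauges satisfy \<open>h 0 = 0\<close>.\<close>

definition hausdorff_premeasure ::
    "(real \<Rightarrow> real) \<Rightarrow> real \<Rightarrow> 'a::metric_space set \<Rightarrow> ennreal" where
  "hausdorff_premeasure h \<delta> E =
     Inf {(\<Sum>k. ennreal (h (diameter (U k)))) | U :: nat \<Rightarrow> 'a set.
            E \<subseteq> (\<Union>k. U k) \<and> (\<forall>k. bounded (U k) \<and> diameter (U k) \<le> \<delta>)}"

definition hausdorff_measure :: "(real \<Rightarrow> real) \<Rightarrow> 'a::metric_space set \<Rightarrow> ennreal" where
  "hausdorff_measure h E = Lim (at_right 0) (\<lambda>\<delta>. hausdorff_premeasure h \<delta> E)"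

text \<open>The infimum runs over \<open>s > 0\<close>, so that \<open>\<lambda>t. t powr s\<close> is a gauge (with \<open>0 powr s = 0\<close>);
  it is taken in the extended reals, so that it is \<open>\<infinity>\<close> if there is no such \<open>s\<close>.\<close>

definition hausdorff_dimension :: "'a::metric_space set \<Rightarrow> ereal" where
  "hausdorff_dimension E =
     Inf {ereal s | s :: real. s > 0 \<and> hausdorff_measure (\<lambda>t. t powr s) E = 0}"

text \<open>Only the values at small \<open>t\<close> are relevant to \<^const>\<open>hausdorff_measure\<close>.\<close>

definition log_gauge :: "real \<Rightarrow> real" where
  "log_gauge t = (if t = 0 then 0 else 1 / \<bar>ln t\<bar>)"

lemma hausdorff_premeasure_antimono:
  assumes "\<delta> \<le> \<delta>'"
  shows "hausdorff_premeasure h \<delta>' E \<le> hausdorff_premeasure h \<delta> E"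
  unfolding hausdorff_premeasure_def
  by (rule Inf_superset_mono) (use assms order_trans in blast)

lemma hausdorff_premeasure_tendsto_SUP:
  "((\<lambda>\<delta>. hausdorff_premeasure h \<delta> E) \<longlongrightarrow> (SUP \<delta>\<in>{0<..}. hausdorff_premeasure h \<delta> E))
     (at_right 0)"
proof (rule order_tendstoI)
  fix c assume "c < (SUP \<delta>\<in>{0<..}. hausdorff_premeasure h \<delta> E)"
  then obtain d where d: "d > 0" "c < hausdorff_premeasure h d E"
    by (auto simp: less_SUP_iff)
  have "\<forall>\<^sub>F \<delta> in at_right 0. \<delta> < d"
    using d(1) by (auto simp: eventually_at_right_field)
  then show "\<forall>\<^sub>F \<delta> in at_right 0. c < hausdorff_premeasure h \<delta> E"
    by eventually_elim (use d(2) hausdorff_premeasure_antimono less_le_trans less_imp_le in metis)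
next
  fix c assume *: "(SUP \<delta>\<in>{0<..}. hausdorff_premeasure h \<delta> E) < c"
  have "hausdorff_premeasure h \<delta> E < c" if "\<delta> > 0" for \<delta>
    using that by (intro le_less_trans[OF SUP_upper *]) auto
  then show "\<forall>\<^sub>F \<delta> in at_right 0. hausdorff_premeasure h \<delta> E < c"
    by (auto simp: eventually_at_right_field intro: exI[of _ 1])
qed

lemma hausdorff_measure_eq_SUP:
  "hausdorff_measure h E = (SUP \<delta>\<in>{0<..}. hausdorff_premeasure h \<delta> E)"
  unfolding hausdorff_measure_def
  by (rule tendsto_Lim[OF _ hausdorff_premeasure_tendsto_SUP]) simp

end

theory Submission imports Defs begin

text \<open>The affine map \<open>x \<mapsto> a x + b\<close> takes an integer value at no more than one point of \<open>[0,1]\<close>, and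
  distinct points of \<open>[0,1]\<close> never have the same image modulo 1. Hence \<open>f\<^sub>\<plusminus>\<close> maps disjoint
  intervals to disjoint intervals, except that one of them may be cut into two, so that
  \<open>f\<^sub>\<plusminus>\<^sup>n([0,1])\<close> consists of at most \<open>n + 1\<close> intervals, each of length at most \<open>a\<^sup>n\<close>. Using
  these as covers bounds \<open>\<H>\<^sub>h(\<Lambda>\<^sub>\<plusminus>)\<close> by the limit inferior of \<open>(n + 1) h(a\<^sup>n)\<close>.\<close>

section \<open>Hausdorff measures and finite covers\<close>

text \<open>Enumerate \<open>P\<close> and pad with empty sets, which have diameter 0 and cost
  \<open>h 0 = 0\<close>. The cost bound \<open>c\<close> is required member by member, so
  monotonicity of \<open>h\<close> can be settled where the lemma is applied.\<close>

lemma hausdorff_premeasure_le_finite_cover: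
  fixes E :: "'a::metric_space set"
  assumes "finite P" and "E \<subseteq> \<Union>P"
    and "\<And>A. A \<in> P \<Longrightarrow> bounded A" and "\<And>A. A \<in> P \<Longrightarrow> diameter A \<le> \<delta>"
    and h: "\<And>A. A \<in> P \<Longrightarrow> h (diameter A) \<le> c"
    and "h 0 = 0" and "0 \<le> \<delta>" and "0 \<le> c" and card: "card P \<le> N"
  shows "hausdorff_premeasure h \<delta> E \<le> ennreal (real N * c)"
proof -
  obtain g where g: "bij_betw g {..<card P} P"
    using \<open>finite P\<close> by (metis bij_betw_from_nat_into_finite)
  define U where "U k = (if k < card P then g k else {})" for k
  have U: "U k \<in> P" if "k < card P" for k
    using that g by (auto simp: U_def bij_betw_def)
  have U0: "U k = {}" if "\<not> k < card P" for k
    using that by (simp add: U_def)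
  have "\<Union>P \<subseteq> (\<Union>k. U k)"
    using g by (force simp: U_def bij_betw_def)
  with assms(2) have "E \<subseteq> (\<Union>k. U k)" by (rule subset_trans)
  moreover have "bounded (U k) \<and> diameter (U k) \<le> \<delta>" for k
    using assms U[of k] U0[of k] by (cases "k < card P") auto
  ultimately have "hausdorff_premeasure h \<delta> E \<le> (\<Sum>k. ennreal (h (diameter (U k))))"
    unfolding hausdorff_premeasure_def by (intro Inf_lower) blast
  also have "\<dots> = (\<Sum>k<card P. ennreal (h (diameter (U k))))"
    by (rule suminf_finite) (use U0 \<open>h 0 = 0\<close> in auto)
  also have "\<dots> \<le> (\<Sum>k<card P. ennreal c)"
    by (intro sum_mono ennreal_leI h U) simp
  also have "\<dots> = ennreal (real (card P) * c)"
    using \<open>0 \<le> c\<close> by (simp add: ennreal_mult ennreal_of_nat_eq_real_of_nat)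
  also have "\<dots> \<le> ennreal (real N * c)"
    using \<open>0 \<le> c\<close> card by (intro ennreal_leI mult_right_mono) auto
  finally show ?thesis .
qed

section \<open>Intervals under a multi-valued contracted rotation\<close>

lemma f_pm_subset:
  assumes "y \<in> f_pm a b K"
  shows "y \<in> {0..1} \<and> (\<exists>x\<in>K. \<exists>k::int. y = a * x + b - of_int k)"
proof -
  obtain x where x: "x \<in> K" "y = f_minus a b x \<or> y = f_plus a b x"
    using assms by (auto simp: f_pm_def)
  have "f_minus a b x = a * x + b - of_int \<lfloor>a * x + b\<rfloor>"
    by (simp add: f_minus_def frac_def)
  \<comment> \<open>The subtracted integer is the ceiling of \<open>a * x + b\<close> minus
    1.\<close>
  moreover have "f_plus a b x = a * x + b - of_int (- \<lfloor>- (a * x + b)\<rfloor> - 1)"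
    by (simp add: f_plus_def frac_plus_def frac_def)
  moreover have "f_minus a b x \<in> {0..1}" "f_plus a b x \<in> {0..1}"
    using frac_ge_0[of "a * x + b"] frac_lt_1[of "a * x + b"]
      frac_ge_0[of "- (a * x + b)"] frac_lt_1[of "- (a * x + b)"]
    by (auto simp: f_minus_def f_plus_def frac_plus_def simp del: frac_ge_0)
  ultimately show ?thesis using x by blast
qed

text \<open>Cutting with the closed interval captures both values of the multi-valued map: a point
  with \<open>a * x + b = k\<close> contributes 0 to branch \<open>k\<close> and 1 to branch
  \<open>k - 1\<close>.\<close>

definition branch :: "real \<Rightarrow> real \<Rightarrow> real set \<Rightarrow> int \<Rightarrow> real set" where
  "branch a b A k = (\<lambda>x. a * x + b - of_int k) ` A \<inter> {0..1}"

text \<open>A common point yields \<open>x\<close>, \<open>x'\<close> in the unit interval with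
  \<open>a * (x - x')\<close> an integer of absolute value at most \<open>a < 1\<close>, hence 0. So
  both the indices and the preimages agree.\<close>

lemma branch_disjoint:
  assumes "0 < a" "a < 1" "A \<subseteq> {0..1}" "B \<subseteq> {0..1}" "A = B \<or> A \<inter> B = {}"
    and "(A, k) \<noteq> (B, j)"
  shows "branch a b A k \<inter> branch a b B j = {}"
proof (rule ccontr)
  assume "\<not> ?thesis"
  then obtain x x' where x: "x \<in> A" "x' \<in> B" "a * x + b - of_int k = a * x' + b - of_int j"
    by (auto simp: branch_def)
  have eq: "a * (x - x') = of_int (k - j)" using x(3) by (simp add: algebra_simps)
  have "x \<in> {0..1}" "x' \<in> {0..1}" using x assms(3,4) by blast+
  then have "\<bar>x - x'\<bar> \<le> 1" by auto
  then have "a * \<bar>x - x'\<bar> \<le> a" using assms(1) by (intro mult_left_le) auto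
  with assms(1,2) have "\<bar>a * (x - x')\<bar> < 1" by (simp only: abs_mult)
  then have "k = j" unfolding eq by linarith
  with eq have "x = x'" using assms(1) by simp
  with x assms(5,6) \<open>k = j\<close> show False by blast
qed

lemma branch_dist_le:
  assumes "0 < a" "\<And>x y. x \<in> A \<Longrightarrow> y \<in> A \<Longrightarrow> \<bar>x - y\<bar> \<le> l"
    and "x \<in> branch a b A k" "y \<in> branch a b A k"
  shows "\<bar>x - y\<bar> \<le> a * l"
proof -
  obtain u v where uv: "u \<in> A" "v \<in> A" "x = a * u + b - of_int k" "y = a * v + b - of_int k"
    using assms by (auto simp: branch_def)
  have "\<bar>x - y\<bar> = a * \<bar>u - v\<bar>"
    using uv assms(1) by (simp add: abs_mult flip: right_diff_distrib)
  with assms uv show ?thesis by (auto intro: mult_left_mono)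
qed

lemma is_interval_branch:
  assumes "is_interval A"
  shows "is_interval (branch a b A k)"
proof -
  have "connected ((\<lambda>x. a * x + b - of_int k) ` A)"
    using assms by (intro connected_continuous_image continuous_intros)
      (simp add: is_interval_connected)
  then show ?thesis
    unfolding branch_def
    by (intro is_interval_Int) (simp_all add: is_interval_connected_1)
qed

text \<open>Over \<open>A\<close> the affine map increases by less than 1, so occurring indices
  differ by at most 1. Two of them occur only if the integer between is attained on the interval
  \<open>A\<close>.\<close>

lemma card_branches_le:
  fixes a b :: real
  assumes "0 < a" "a < 1" "is_interval A" "A \<subseteq> {0..1}"
  defines "K \<equiv> {k. branch a b A k \<noteq> {}}"
  shows "finite K" and "card K \<le> (if \<exists>x\<in>A. a * x + b \<in> \<int> then 2 else 1)"
proof -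
  have K: "\<exists>x\<in>A. of_int k \<le> a * x + b \<and> a * x + b \<le> of_int k + 1" if "k \<in> K" for k
    using that by (auto simp: K_def branch_def)
  have gap: "l \<le> k + 1" if kl: "k \<in> K" "l \<in> K" for k l
  proof (rule ccontr)
    assume "\<not> l \<le> k + 1"
    then have "real_of_int l \<ge> of_int k + 2" by linarith
    obtain x y where xy: "x \<in> A" "y \<in> A" "a * x + b \<le> of_int k + 1" "of_int l \<le> a * y + b"
      using K kl by blast
    have "a * (y - x) \<ge> 1"
      using xy \<open>real_of_int l \<ge> of_int k + 2\<close> by (simp add: algebra_simps)
    moreover have "x \<in> {0..1}" "y \<in> {0..1}" using xy assms(4) by blast+
    then have "y - x \<le> 1" by simp
    then have "a * (y - x) \<le> a" using assms(1) by (simp add: mult_left_le)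
    ultimately show False using assms(2) by linarith
  qed
  have cut: "\<exists>x\<in>A. a * x + b \<in> \<int>" if kl: "k \<in> K" "l \<in> K" "k < l" for k l
  proof -
    have "real_of_int l \<ge> of_int k + 1" using kl by linarith
    obtain x y where xy: "x \<in> A" "y \<in> A" "a * x + b \<le> of_int k + 1" "of_int l \<le> a * y + b"
      using K kl by blast
    \<comment> \<open>The preimage of \<open>l\<close>; it lies in \<open>A\<close> because
      \<open>a * x + b \<le> k + 1 \<le> l \<le> a * y + b\<close>.\<close>
    define c where "c = (of_int l - b) / a"
    have "x \<le> c" "c \<le> y"
      using xy \<open>real_of_int l \<ge> of_int k + 1\<close> assms(1) by (simp_all add: c_def field_simps)
    with xy assms(3) have "c \<in> A" by (meson mem_is_interval_1_I)
    moreover have "a * c + b = of_int l" using assms(1) by (simp add: c_def)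
    ultimately show ?thesis by (metis Ints_of_int)
  qed
  have "finite K \<and> card K \<le> (if \<exists>x\<in>A. a * x + b \<in> \<int> then 2 else 1)"
  proof (cases "K = {}")
    case False
    \<comment> \<open>A crude enclosure around any index gives finiteness first, so that the minimum
      exists; measured from the minimum, two candidates remain.\<close>
    then obtain k0 where k0: "k0 \<in> K" by blast
    have "k \<in> {k0 - 1..k0 + 1}" if "k \<in> K" for k
      using gap[OF k0 that] gap[OF that k0] by simp
    then have "K \<subseteq> {k0 - 1..k0 + 1}" by blast
    then have fin: "finite K" by (rule finite_subset) simp
    define m where "m = Min K"
    have m: "m \<in> K" "\<And>k. k \<in> K \<Longrightarrow> m \<le> k" using fin False by (simp_all add: m_def)
    have "k \<in> {m, m + 1}" if "k \<in> K" for k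
      using gap[OF m(1) that] m(2)[OF that] by auto
    then have two: "K \<subseteq> {m, m + 1}" by blast
    show ?thesis
    proof (cases "\<exists>x\<in>A. a * x + b \<in> \<int>")
      case True
      have "card K \<le> card {m, m + 1}" by (rule card_mono) (use two in auto)
      with True fin show ?thesis by simp
    next
      case no: False
      have "k = m" if "k \<in> K" for k
        using cut[OF m(1) that] m(2)[OF that] no by linarith
      then have "K = {m}" using m(1) by blast
      with no show ?thesis by simp
    qed
  qed auto
  then show "finite K" and "card K \<le> (if \<exists>x\<in>A. a * x + b \<in> \<int> then 2 else 1)"
    by blast+
qed

lemma cut_point_unique:
  assumes "0 < a" "a < 1" "0 \<le> x" "x \<le> 1" "0 \<le> y" "y \<le> 1"
    and "a * x + b \<in> \<int>" "a * y + b \<in> \<int>"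
  shows "x = (y :: real)"
proof -
  have "a * x + b - (a * y + b) \<in> \<int>" using assms by (intro Ints_diff)
  then obtain k where k: "a * (x - y) = of_int k"
    by (auto elim!: Ints_cases simp: algebra_simps)
  have "\<bar>a * (x - y)\<bar> \<le> a * 1"
    using assms by (subst abs_mult) (intro mult_mono, auto)
  then have "k = 0" using k assms by linarith
  with k assms show ?thesis by simp
qed

text \<open>Disjointness and the interval property serve the induction: with them at most one member
  contains a cut point, so a step adds at most one set instead of doubling the count. Lengths are
  stated through distances of points, which the affine map scales by \<open>a\<close>.\<close>

lemma f_pm_funpow_cover:
  assumes "0 < a" "a < 1"
  shows "\<exists>P. finite P \<and> card P \<le> Suc n \<and> disjoint P \<and> (f_pm a b ^^ n) {0..1} \<subseteq> \<Union>P \<and>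
    (\<forall>A\<in>P. is_interval A \<and> A \<subseteq> {0..1} \<and> (\<forall>x\<in>A. \<forall>y\<in>A. \<bar>x - y\<bar> \<le> a ^ n))"
proof (induction n)
  case 0
  show ?case by (rule exI[of _ "{{0..1}}"]) (auto simp: is_interval_cc)
next
  case (Suc n)
  then obtain P where P: "finite P" "card P \<le> Suc n" "disjoint P"
      "(f_pm a b ^^ n) {0..1} \<subseteq> \<Union>P"
    and *: "\<forall>A\<in>P. is_interval A \<and> A \<subseteq> {0..1} \<and> (\<forall>x\<in>A. \<forall>y\<in>A. \<bar>x - y\<bar> \<le> a ^ n)"
    by (elim exE conjE)
  have PA: "\<And>A. A \<in> P \<Longrightarrow> is_interval A" "\<And>A. A \<in> P \<Longrightarrow> A \<subseteq> {0..1}"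
      "\<And>A x y. A \<in> P \<Longrightarrow> x \<in> A \<Longrightarrow> y \<in> A \<Longrightarrow> \<bar>x - y\<bar> \<le> a ^ n"
    using * by simp_all
  define K where "K A = {k. branch a b A k \<noteq> {}}" for A
  define C where "C = {A \<in> P. \<exists>x\<in>A. a * x + b \<in> \<int>}"
  define Q where "Q = (\<lambda>(A, k). branch a b A k) ` (SIGMA A:P. K A)"
  have K: "finite (K A)" "card (K A) \<le> 1 + (if A \<in> C then 1 else 0)" if "A \<in> P" for A
    using card_branches_le[OF assms PA(1,2)[OF that], of b] that
    by (auto simp: K_def C_def split: if_splits)
  \<comment> \<open>Both members contain the unique cut point, so disjointness identifies
    them.\<close>
  have "A = B" if AB: "A \<in> C" "B \<in> C" for A B
  proof -
    obtain x y where xy: "x \<in> A" "y \<in> B" "a * x + b \<in> \<int>" "a * y + b \<in> \<int>"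
      "A \<in> P" "B \<in> P"
      using AB by (auto simp: C_def)
    moreover have "x \<in> {0..1}" "y \<in> {0..1}" using xy PA(2) by blast+
    ultimately have "x = y" using assms cut_point_unique[of a x y b] by auto
    with xy P(3) show ?thesis by (auto simp: disjoint_def)
  qed
  then have C: "card C \<le> 1"
    using P(1) by (auto simp: C_def card_le_Suc0_iff_eq)
  have finQ: "finite Q" unfolding Q_def using P(1) K by auto
  \<comment> \<open>Each member of \<open>P\<close> contributes one branch, plus one more if it is
    cut; the extra terms sum to \<open>card C\<close>.\<close>
  have "card Q \<le> card (SIGMA A:P. K A)"
    unfolding Q_def by (intro card_image_le finite_SigmaI P(1) K)
  also have "\<dots> = (\<Sum>A\<in>P. card (K A))" using P(1) K by (simp add: card_SigmaI)
  also have "\<dots> \<le> (\<Sum>A\<in>P. 1 + (if A \<in> C then 1 else 0))" by (intro sum_mono K)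
  also have "\<dots> = card P + card (P \<inter> C)"
    using P(1) by (simp only: sum.distrib sum.If_cases) simp
  also have "P \<inter> C = C" by (auto simp: C_def)
  finally have cardQ: "card Q \<le> Suc (Suc n)" using C P(2) by linarith
  have disj: "disjoint Q"
  proof (rule disjointI)
    fix X Y assume "X \<in> Q" "Y \<in> Q" "X \<noteq> Y"
    then obtain A k B j where *: "A \<in> P" "B \<in> P" "X = branch a b A k" "Y = branch a b B j"
      "(A, k) \<noteq> (B, j)" by (auto simp: Q_def)
    moreover have "A = B \<or> A \<inter> B = {}" using * P(3) by (auto simp: disjoint_def)
    ultimately show "X \<inter> Y = {}" using branch_disjoint[OF assms] PA(2) by metis
  qed
  have cover: "(f_pm a b ^^ Suc n) {0..1} \<subseteq> \<Union>Q"
  proof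
    fix y assume "y \<in> (f_pm a b ^^ Suc n) {0..1}"
    then obtain x k where xk: "y \<in> {0..1}" "x \<in> (f_pm a b ^^ n) {0..1}"
      "y = a * x + b - of_int k"
      using f_pm_subset[of y a b "(f_pm a b ^^ n) {0..1}"] by auto
    then obtain A where A: "A \<in> P" "x \<in> A" using P(4) by blast
    then have "y \<in> branch a b A k" using xk by (auto simp: branch_def)
    moreover from this have "k \<in> K A" by (auto simp: K_def)
    ultimately show "y \<in> \<Union>Q" using A(1) by (auto simp: Q_def)
  qed
  have "is_interval X \<and> X \<subseteq> {0..1} \<and> (\<forall>x\<in>X. \<forall>y\<in>X. \<bar>x - y\<bar> \<le> a ^ Suc n)" if X: "X \<in> Q" for X
  proof -
    obtain A k where A: "A \<in> P" "X = branch a b A k" using X by (auto simp: Q_def)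
    have "X \<subseteq> {0..1}" using A by (auto simp: branch_def)
    moreover have "is_interval X" using A PA(1) is_interval_branch by blast
    moreover have "\<forall>x\<in>X. \<forall>y\<in>X. \<bar>x - y\<bar> \<le> a ^ Suc n"
      using branch_dist_le[OF assms(1) PA(3)[OF A(1)]] A(2) by simp
    ultimately show ?thesis by blast
  qed
  with finQ cardQ disj cover show ?case by blast
qed

section \<open>The limit set\<close>

text \<open>The limit set lies in every iterate, so any level \<open>n\<close> fine enough for
  \<open>\<delta>\<close> supplies a cover. Monotonicity of \<open>h\<close> is asked only up to
  \<open>a ^ n\<close> because \<open>log_gauge\<close> is increasing only below 1.\<close>

lemma hausdorff_premeasure_Lambda_pm_le:
  assumes "0 < a" "a < 1" "a ^ n \<le> \<delta>" "h 0 = 0"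
    and mono: "\<And>t. 0 \<le> t \<Longrightarrow> t \<le> a ^ n \<Longrightarrow> h t \<le> h (a ^ n)"
  shows "hausdorff_premeasure h \<delta> (Lambda_pm a b) \<le> ennreal (real (Suc n) * h (a ^ n))"
proof -
  obtain P where P: "finite P" "card P \<le> Suc n" "(f_pm a b ^^ n) {0..1} \<subseteq> \<Union>P"
    and *: "\<forall>A\<in>P. is_interval A \<and> A \<subseteq> {0..1} \<and> (\<forall>x\<in>A. \<forall>y\<in>A. \<bar>x - y\<bar> \<le> a ^ n)"
    using f_pm_funpow_cover[OF assms(1,2), of n b] by (elim exE conjE)
  have bdd: "bounded A" if "A \<in> P" for A
    using * that by (blast intro: bounded_subset[OF bounded_closed_interval])
  have diam: "diameter A \<le> a ^ n" if "A \<in> P" for A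
    using assms(1) * that by (intro diameter_le) auto
  show ?thesis
  proof (rule hausdorff_premeasure_le_finite_cover[OF P(1)])
    show "Lambda_pm a b \<subseteq> \<Union>P" using P(3) by (auto simp: Lambda_pm_def)
    show "h (diameter A) \<le> h (a ^ n)" if "A \<in> P" for A
      using diam[OF that] diameter_ge_0[OF bdd[OF that]] mono by blast
    show "diameter A \<le> \<delta>" if "A \<in> P" for A using diam[OF that] assms(3) by simp
    show "0 \<le> \<delta>" using assms(1,3) by (smt (verit) zero_le_power)
    show "0 \<le> h (a ^ n)" using mono[of 0] assms(1,4) by simp
  qed (use P bdd assms in auto)
qed

text \<open>Below 1 the logarithm is negative, so its absolute value falls as the argument grows.
  The strict bound matters: division by zero makes \<open>log_gauge 1 = 0\<close>.\<close>

lemma log_gauge_mono: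
  assumes "0 \<le> s" "s \<le> t" "t < 1"
  shows "log_gauge s \<le> log_gauge t"
proof (cases "s = 0")
  case False
  with assms have "ln s \<le> ln t" "ln t < 0" by auto
  with False assms show ?thesis by (simp add: log_gauge_def field_simps)
qed (simp add: log_gauge_def)

lemma hausdorff_measure_log_gauge_Lambda_pm:
  assumes "0 < a" "a < 1"
  shows "hausdorff_measure log_gauge (Lambda_pm a b) \<le> ennreal (2 / \<bar>ln a\<bar>)"
  unfolding hausdorff_measure_eq_SUP
proof (rule SUP_least)
  fix \<delta> :: real assume "\<delta> \<in> {0<..}"
  then obtain m where "a ^ m < \<delta>" using real_arch_pow_inv[of \<delta> a] assms by auto
  \<comment> \<open>A positive exponent ensures \<open>a ^ n < 1\<close> and
    \<open>(n + 1) / n \<le> 2\<close>, which is the source of the constant 2.\<close>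
  define n where "n = Suc m"
  have "a ^ n \<le> a ^ m" using assms by (intro power_decreasing) (auto simp: n_def)
  with \<open>a ^ m < \<delta>\<close> have n: "a ^ n \<le> \<delta>" "0 < n" "a ^ n < 1"
    using assms power_Suc_less_one[of a m] unfolding n_def by linarith+
  have "hausdorff_premeasure log_gauge \<delta> (Lambda_pm a b)
      \<le> ennreal (real (Suc n) * log_gauge (a ^ n))"
    using n assms log_gauge_mono
    by (intro hausdorff_premeasure_Lambda_pm_le) (auto simp: log_gauge_def[of 0])
  also have "real (Suc n) * log_gauge (a ^ n) = real (Suc n) / real n / \<bar>ln a\<bar>"
    using assms n by (simp add: log_gauge_def ln_realpow abs_mult)
  also have "\<dots> \<le> 2 / \<bar>ln a\<bar>"
    using n(2) by (intro divide_right_mono) (auto simp: field_simps)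
  finally show "hausdorff_premeasure log_gauge \<delta> (Lambda_pm a b) \<le> ennreal (2 / \<bar>ln a\<bar>)"
    by (simp add: ennreal_leI)
qed

lemma hausdorff_measure_powr_Lambda_pm:
  assumes "0 < a" "a < 1" "0 < s"
  shows "hausdorff_measure (\<lambda>t. t powr s) (Lambda_pm a b) = 0"
proof -
  have "hausdorff_premeasure (\<lambda>t. t powr s) \<delta> (Lambda_pm a b) \<le> 0" if "0 < \<delta>" for \<delta>
  \<comment> \<open>With \<open>\<delta>\<close> fixed and \<open>n\<close> growing, the
    level-\<open>n\<close> bound is \<open>(n + 1) * r ^ n\<close> for
    \<open>r = a powr s < 1\<close>, which tends to 0.\<close>
  proof (rule tendsto_lowerbound)
    define r where "r = a powr s"
    have r: "0 < r" "r < 1" using assms powr_less_mono2[of s a 1] by (auto simp: r_def)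
    have "(\<lambda>n. real n * r ^ n) \<longlonglongrightarrow> 0" using r by (intro powser_times_n_limit_0) auto
    moreover have "(\<lambda>n. r ^ n) \<longlonglongrightarrow> 0" using r by (intro LIMSEQ_power_zero) auto
    ultimately have "(\<lambda>n. real n * r ^ n + r ^ n) \<longlonglongrightarrow> 0 + 0" by (rule tendsto_add)
    then have "(\<lambda>n. real (Suc n) * r ^ n) \<longlonglongrightarrow> 0" by (simp add: algebra_simps)
    moreover have "(a ^ n) powr s = r ^ n" for n
      using assms by (simp add: r_def powr_powr powr_realpow[symmetric] mult.commute)
    ultimately have "(\<lambda>n. real (Suc n) * (a ^ n) powr s) \<longlonglongrightarrow> 0" by simp
    then show "(\<lambda>n. ennreal (real (Suc n) * (a ^ n) powr s)) \<longlonglongrightarrow> 0"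
      using tendsto_ennrealI by fastforce
    have "(\<lambda>n. a ^ n) \<longlonglongrightarrow> 0" using assms by (intro LIMSEQ_power_zero) auto
    then have "\<forall>\<^sub>F n in sequentially. a ^ n < \<delta>" using that by (rule order_tendstoD)
    then show "\<forall>\<^sub>F n in sequentially. hausdorff_premeasure (\<lambda>t. t powr s) \<delta> (Lambda_pm a b)
        \<le> ennreal (real (Suc n) * (a ^ n) powr s)"
      by eventually_elim
        (use assms in \<open>intro hausdorff_premeasure_Lambda_pm_le, auto intro: powr_mono2\<close>)
  qed simp
  then have "hausdorff_measure (\<lambda>t. t powr s) (Lambda_pm a b) \<le> 0"
    unfolding hausdorff_measure_eq_SUP by (intro SUP_least) auto
  then show ?thesis by simp
qed

theorem theorem7p3:
  fixes a b :: real
  assumes "0 < a" and "a < 1" and "0 \<le> b" and "b < 1"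
  shows "hausdorff_dimension (Lambda_pm a b) = 0 \<and>
         hausdorff_measure log_gauge (Lambda_pm a b) < \<infinity>"
proof
  \<comment> \<open>Every positive exponent gives measure zero, so the infimum runs over all
    positive reals.\<close>
  have "hausdorff_dimension (Lambda_pm a b) = Inf (ereal ` {0<..})"
    unfolding hausdorff_dimension_def using hausdorff_measure_powr_Lambda_pm[OF assms(1,2)]
    by (intro arg_cong[where f = Inf]) auto
  also have "\<dots> = 0"
  proof (rule antisym)
    show "Inf (ereal ` {0<..}) \<le> 0"
    proof (rule ereal_le_epsilon2)
      show "Inf (ereal ` {0<..}) \<le> 0 + ereal e" if "0 < e" for e
        using that by (auto intro: INF_lower)
    qed
    show "0 \<le> Inf (ereal ` {0<..})" by (auto intro: INF_greatest)
  qed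
  finally show "hausdorff_dimension (Lambda_pm a b) = 0" .
  show "hausdorff_measure log_gauge (Lambda_pm a b) < \<infinity>"
    using hausdorff_measure_log_gauge_Lambda_pm[OF assms(1,2), of b]
    by (rule le_less_trans) simp
qed

end
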